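(* Let $(P,\le,{}',0,1)$ be a Boolean poset. Then for all $x,y\in P$, \[x+y=\operatorname{Min}U\big(\operatorname{Max}L(\operatorname{Min}U(x,y)\cup\operatorname{Min}U(x',y'))\big).\]
   Context: For a poset and $A\subseteq P$: $L(A)=\{x\mid x\le a\ \forall a\in A\}$, $U(A)=\{x\mid a\le x\ \forall a\in A\}$; $\operatorname{Max}$, $\operatorname{Min}$ denote sets of maximal/minimal elements; $L(x,y)=L(\{x,y\})$, $L(A,B)=L(A\cup B)$, $\operatorname{Max}L(A,B)=\operatorname{Max}(L(A\cup B))$, $\operatorname{Min}U(A,B)=\operatorname{Min}(U(A\cup B))$, $LU(A)=L(U(A))$; elements are identified with singletons. A complemented poset is a bounded poset $(P,\le,{}',0,1)$ with an antitone involution $'$ (i.e. $x\le y\Rightarrow y'\le x'$ and $x''=x$) such that $L(x,x')=\{0\}$ and $U(x,x')=\{1\}$ for all $x$. A poset is distributive if $L(U(x,y),z)=LU(L(x,z),L(y,z))$ for all $x,y,z$. A Boolean poset is a distributive complemented poset. The symmetric difference is $x+y:=\operatorname{Min}U\big(\operatorname{Max}L(x',y)\cup\operatorname{Max}L(x,y')\big)$.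
   Formalization: Added assumption, since the claim fails for some infinite Boolean posets: for all a,b,c,d, each element of L(Min U(a,b) ∪ Min U(c,d)) lies below a maximal element of that set. This holds in all finite posets, all posets with the ascending chain condition and all lattices. *)

theory Defs
  imports Main
begin

definition lower :: "'a::order set \<Rightarrow> 'a set" where
  "lower A = {x. \<forall>a\<in>A. x \<le> a}"

definition upper :: "'a::order set \<Rightarrow> 'a set" where
  "upper A = {x. \<forall>a\<in>A. a \<le> x}"

definition maximals :: "'a::order set \<Rightarrow> 'a set" where
  "maximals A = {x \<in> A. \<forall>y\<in>A. x \<le> y \<longrightarrow> y = x}"

definition minimals :: "'a::order set \<Rightarrow> 'a set" where
  "minimals A = {x \<in> A. \<forall>y\<in>A. y \<le> x \<longrightarrow> y = x}"

abbreviation MaxL :: "'a::order set \<Rightarrow> 'a set" where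
  "MaxL A \<equiv> maximals (lower A)"

abbreviation MinU :: "'a::order set \<Rightarrow> 'a set" where
  "MinU A \<equiv> minimals (upper A)"

locale complemented_poset =
  fixes compl :: "'a::{order_bot,order_top} \<Rightarrow> 'a"
  assumes compl_antimono: "x \<le> y \<Longrightarrow> compl y \<le> compl x"
    and compl_compl: "compl (compl x) = x"
    and lower_compl: "lower {x, compl x} = {bot}"
    and upper_compl: "upper {x, compl x} = {top}"

locale boolean_poset = complemented_poset compl
  for compl :: "'a::{order_bot,order_top} \<Rightarrow> 'a" +
  assumes distrib: "\<And>x y z :: 'a.
    lower (upper {x, y} \<union> {z}) = lower (upper (lower {x, z} \<union> lower {y, z}))"

definition symmetric_difference :: "('a::order \<Rightarrow> 'a) \<Rightarrow> 'a \<Rightarrow> 'a \<Rightarrow> 'a set" where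
  "symmetric_difference compl x y = MinU (MaxL {compl x, y} \<union> MaxL {x, compl y})"

(* The calculus with Max L and Min U tacitly reads Max L(A) as a stand-in for L(A), i.e. it
   uses U(Max L(A)) = U(L(A)).  In an arbitrary infinite poset Max L(A) can be empty and this
   fails.  The condition below asks for it on the sets A = Min U(a,b) \<union> Min U(c,d); since
   Min U(a,a) = {a}, two-element sets A = {a,c} are included, and under an antitone involution
   the corresponding statement for Min U(a,c) follows.  It holds in every poset with the
   ascending chain condition (in particular in every finite one) and in every lattice.

   Without it the expression for the symmetric difference is false.  Split the natural numbers
   into four infinite sets A, B, C, D and order by inclusion the poset of all finite and all
   cofinite sets together with x = A \<union> B, y = A \<union> C and their complements.  This is a
   Boolean poset in which Max L(x',y), Max L(x,y'), Min U(x,y) and Min U(x',y') are all empty,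
   so that x + y = Min U({}) = {0}, while Min U(Max L({})) = Min U({1}) = {1}. *)
definition max_dominated :: "'a::order itself \<Rightarrow> bool" where
  "max_dominated _ \<longleftrightarrow>
    (\<forall>a b c d :: 'a. \<forall>z \<in> lower (MinU {a, b} \<union> MinU {c, d}).
       \<exists>m \<in> MaxL (MinU {a, b} \<union> MinU {c, d}). z \<le> m)"

end

theory Submission
  imports Defs
begin

text \<open>
  Under the domination hypothesis, \<open>Max L\<close> and \<open>Min U\<close> may be replaced by \<open>L\<close> and \<open>U\<close> inside a
  further cone, so the claim becomes the equality of the upper cones of \<open>L(x',y) \<union> L(x,y')\<close> and of
  \<open>LU(x,y) \<inter> LU(x',y')\<close>. The first set is contained in the second. Conversely, an element \<open>z\<close> of
  the second set lies in \<open>LU(L(x,z) \<union> L(y,z))\<close> by distributivity, and an element \<open>t\<close> of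
  \<open>L(x,z)\<close> lies in \<open>LU(L(x',t) \<union> L(y',t))\<close>, where \<open>L(x',t) = {0}\<close> and \<open>L(y',t) \<subseteq> L(x,y')\<close>.
\<close>

lemma lower_Un: "lower (A \<union> B) = lower A \<inter> lower B"
  by (auto simp: lower_def)

lemma upper_Un: "upper (A \<union> B) = upper A \<inter> upper B"
  by (auto simp: upper_def)

text \<open>An upper bound of the maximal elements also bounds each \<open>z\<close> in
  \<open>A\<close>, through a maximal element above \<open>z\<close>.\<close>

lemma upper_maximals_eq:
  assumes "\<And>z. z \<in> A \<Longrightarrow> \<exists>m\<in>maximals A. z \<le> m"
  shows "upper (maximals A) = upper A"
proof
  show "upper A \<subseteq> upper (maximals A)"
    by (auto simp: upper_def maximals_def)
  show "upper (maximals A) \<subseteq> upper A"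
    using assms by (fastforce simp: upper_def intro: order_trans)
qed

lemma lower_minimals_eq:
  assumes "\<And>z. z \<in> A \<Longrightarrow> \<exists>m\<in>minimals A. m \<le> z"
  shows "lower (minimals A) = lower A"
proof
  show "lower A \<subseteq> lower (minimals A)"
    by (auto simp: lower_def minimals_def)
  show "lower (minimals A) \<subseteq> lower A"
    using assms by (fastforce simp: lower_def intro: order_trans)
qed

lemma MinU_pair_same: "MinU {a, a} = {a}"
  by (auto simp: minimals_def upper_def)

lemma max_dominated_upper_MaxL_MinU:
  fixes a b c d :: "'a::order"
  assumes "max_dominated TYPE('a)"
  shows "upper (MaxL (MinU {a, b} \<union> MinU {c, d})) = upper (lower (MinU {a, b} \<union> MinU {c, d}))"
  using assms by (intro upper_maximals_eq) (simp add: max_dominated_def)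

text \<open>The case \<open>b = a\<close>, \<open>d = c\<close> of the hypothesis, where both
  \<open>MinU\<close> sets collapse to singletons.\<close>

lemma max_dominated_pair:
  fixes a c :: "'a::order"
  assumes "max_dominated TYPE('a)" "z \<in> lower {a, c}"
  shows "\<exists>m\<in>MaxL {a, c}. z \<le> m"
proof -
  have "MinU {a, a} \<union> MinU {c, c} = {a, c}"
    by (simp add: MinU_pair_same[simplified] insert_commute)
  then show ?thesis
    using assms unfolding max_dominated_def by metis
qed

context complemented_poset
begin

lemma compl_le_compl_iff: "compl x \<le> compl y \<longleftrightarrow> y \<le> x"
  by (metis compl_antimono compl_compl)

lemma le_compl_iff: "x \<le> compl y \<longleftrightarrow> y \<le> compl x"
  by (metis compl_antimono compl_compl)

lemma compl_mem_lower_pair_iff: "compl z \<in> lower {compl a, compl b} \<longleftrightarrow> z \<in> upper {a, b}"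
  by (simp add: lower_def upper_def compl_le_compl_iff)

text \<open>The involution reverses the order in both directions, so it exchanges maximal lower
  bounds with minimal upper bounds.\<close>

lemma compl_MaxL_pair:
  assumes "m \<in> MaxL {compl a, compl b}"
  shows "compl m \<in> MinU {a, b}"
proof -
  have "compl m \<in> upper {a, b}"
    using assms compl_mem_lower_pair_iff[of "compl m" a b] by (simp add: maximals_def compl_compl)
  moreover have "y = compl m" if "y \<in> upper {a, b}" "y \<le> compl m" for y
  proof -
    have "compl y \<in> lower {compl a, compl b}" "m \<le> compl y"
      using that by (simp_all add: compl_mem_lower_pair_iff le_compl_iff[of m])
    then have "compl y = m"
      using assms by (simp add: maximals_def)
    then show ?thesis
      using compl_compl by metis
  qed
  ultimately show ?thesis
    by (simp add: minimals_def)
qed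

text \<open>The hypothesis only provides maximal lower bounds. Applied to \<open>compl z\<close> and
  the complemented pair, it yields, after complementing, a minimal upper bound below
  \<open>z\<close>.\<close>

lemma lower_MinU_pair:
  fixes a b :: 'a
  assumes "max_dominated TYPE('a)"
  shows "lower (MinU {a, b}) = lower (upper {a, b})"
proof (rule lower_minimals_eq)
  fix z assume "z \<in> upper {a, b}"
  then obtain m where "m \<in> MaxL {compl a, compl b}" "compl z \<le> m"
    using max_dominated_pair[OF assms, of "compl z"] compl_mem_lower_pair_iff by blast
  then show "\<exists>m\<in>MinU {a, b}. m \<le> z"
    using compl_MaxL_pair by (metis compl_antimono compl_compl)
qed

end

context boolean_poset
begin

text \<open>Distributivity as a case split: it gives t \<in> L(U(a,b),t) = LU(L(a,t), L(b,t)), which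
  replaces the lattice identity t = (a \<and> t) \<or> (b \<and> t).\<close>

lemma le_via_distrib:
  fixes t :: 'a
  assumes "t \<in> lower (upper {a, b})"
    and "\<And>s. s \<le> a \<Longrightarrow> s \<le> t \<Longrightarrow> s \<le> w"
    and "\<And>s. s \<le> b \<Longrightarrow> s \<le> t \<Longrightarrow> s \<le> w"
  shows "t \<le> w"
proof -
  have "t \<in> lower (upper {a, b} \<union> {t})"
    using assms(1) by (auto simp: lower_def)
  then have "t \<in> lower (upper (lower {a, t} \<union> lower {b, t}))"
    by (simp only: distrib)
  moreover have "w \<in> upper (lower {a, t} \<union> lower {b, t})"
    using assms(2,3) by (auto simp: upper_def lower_def)
  ultimately show ?thesis
    by (simp add: lower_def)
qed

lemma le_compl_self_imp_bot:
  assumes "s \<le> x" "s \<le> compl x"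
  shows "s = bot"
proof -
  have "s \<in> lower {x, compl x}"
    using assms by (simp add: lower_def)
  then show ?thesis
    by (simp add: lower_compl)
qed

lemma upper_symmetric_difference:
  "upper (lower {compl x, y} \<union> lower {x, compl y}) =
   upper (lower (upper {x, y}) \<inter> lower (upper {compl x, compl y}))"
proof
  \<comment> \<open>Each of the two lower cones takes one element from \<open>{x, y}\<close> and one
    from \<open>{compl x, compl y}\<close>, so its members lie below all upper bounds of either
    pair.\<close>
  have "lower {compl x, y} \<union> lower {x, compl y} \<subseteq>
      lower (upper {x, y}) \<inter> lower (upper {compl x, compl y})"
    by (auto simp: lower_def upper_def intro: order_trans)
  then show "upper (lower (upper {x, y}) \<inter> lower (upper {compl x, compl y})) \<subseteq>
      upper (lower {compl x, y} \<union> lower {x, compl y})"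
    by (auto simp: upper_def)
next
  show "upper (lower {compl x, y} \<union> lower {x, compl y}) \<subseteq>
      upper (lower (upper {x, y}) \<inter> lower (upper {compl x, compl y}))"
  proof
    fix w assume "w \<in> upper (lower {compl x, y} \<union> lower {x, compl y})"
    then have w: "s \<le> compl x \<Longrightarrow> s \<le> y \<Longrightarrow> s \<le> w" "s \<le> x \<Longrightarrow> s \<le> compl y \<Longrightarrow> s \<le> w" for s
      by (auto simp: upper_def lower_def)
    have "z \<le> w" if z: "z \<in> lower (upper {x, y})" "z \<in> lower (upper {compl x, compl y})" for z
    \<comment> \<open>Splitting \<open>z\<close> along \<open>x\<close>, \<open>y\<close> and then
      each part along \<open>compl x\<close>, \<open>compl y\<close> leaves four cases: two force
      \<open>s = bot\<close>, the other two are covered by \<open>w\<close>.\<close>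
    proof (rule le_via_distrib[OF z(1)])
      fix t assume t: "t \<le> x" "t \<le> z"
      have "t \<in> lower (upper {compl x, compl y})"
        using z(2) t(2) by (auto simp: lower_def intro: order_trans)
      then show "t \<le> w"
      proof (rule le_via_distrib)
        show "s \<le> w" if "s \<le> compl x" "s \<le> t" for s
          using le_compl_self_imp_bot[of s x] that t(1) by (metis bot_least order_trans)
        show "s \<le> w" if "s \<le> compl y" "s \<le> t" for s
          using w(2) that t(1) by auto
      qed
    next
      fix t assume t: "t \<le> y" "t \<le> z"
      have "t \<in> lower (upper {compl x, compl y})"
        using z(2) t(2) by (auto simp: lower_def intro: order_trans)
      then show "t \<le> w"
      proof (rule le_via_distrib)
        show "s \<le> w" if "s \<le> compl x" "s \<le> t" for s
          using w(1) that t(1) by auto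
        show "s \<le> w" if "s \<le> compl y" "s \<le> t" for s
          using le_compl_self_imp_bot[of s y] that t(1) by (metis bot_least order_trans)
      qed
    qed
    then show "w \<in> upper (lower (upper {x, y}) \<inter> lower (upper {compl x, compl y}))"
      by (auto simp: upper_def)
  qed
qed

end

theorem theorem4p3:
  fixes compl :: "'a::{order_bot,order_top} \<Rightarrow> 'a"
  assumes "boolean_poset compl"
    and "max_dominated TYPE('a)"
  shows "\<forall>x y. symmetric_difference compl x y =
    MinU (MaxL (MinU {x, y} \<union> MinU {compl x, compl y}))"
proof (intro allI)
  fix x y :: 'a
  interpret boolean_poset compl by fact
  have MaxL: "upper (MaxL {a, b}) = upper (lower {a, b})" for a b :: 'a
    using max_dominated_pair[OF assms(2)] by (rule upper_maximals_eq)
  \<comment> \<open>Both sides of the claim are the minimal elements of an upper cone, so it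
    suffices that the two cones agree.\<close>
  have "upper (MaxL {compl x, y} \<union> MaxL {x, compl y}) =
      upper (lower {compl x, y} \<union> lower {x, compl y})"
    by (simp only: upper_Un MaxL)
  also have "\<dots> = upper (lower (MinU {x, y} \<union> MinU {compl x, compl y}))"
    by (simp only: upper_symmetric_difference lower_Un lower_MinU_pair[OF assms(2)])
  also have "\<dots> = upper (MaxL (MinU {x, y} \<union> MinU {compl x, compl y}))"
    by (simp only: max_dominated_upper_MaxL_MinU[OF assms(2)])
  finally show "symmetric_difference compl x y =
      MinU (MaxL (MinU {x, y} \<union> MinU {compl x, compl y}))"
    by (simp only: symmetric_difference_def)
qed

end
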